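(* Let $d\ge1$, $\lambda_1,\dots,\lambda_d>0$ and $n\ge1$. For $x,z\in W^d$, $$\mathbb{P}_x(S(n)\in dz,\ \tau>n)=\Big(\prod_{j=1}^d\lambda_j^n\Big)e^{-\sum_{j=1}^d\lambda_j(z_j-x_j)}\det\big(q_{n+i-j}(z_j-x_i)\big)_{i,j=1}^d\,dz,$$ where $q_m(u)=\frac{1}{(m-1)!}u^{m-1}1_{\{u>0\}}$ for $m\ge1$ and $q_m\equiv0$ for $m\le0$.
   Context: Let $(X_{ij})_{i\ge1,1\le j\le d}$ be independent exponential random variables, $X_{ij}$ having rate $\lambda_j$. Let $W^d=\{x\in\mathbb{R}^d:x_1\le\dots\le x_d\}$. The random walk $S(n)=(S_1(n),\dots,S_d(n))$ started from $S(0)=x$ is $S_j(n)=x_j+\sum_{i=1}^nX_{ij}$, with law $\mathbb{P}_x$, and $\tau=\inf\{n\ge1:S(n)\notin W^d\}$. The displayed identity says that the right-hand side is the density on $W^d$ of the sub-probability measure $\mathbb{P}_x(S(n)\in\cdot,\ \tau>n)$. *)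

theory Defs
  imports "HOL-Probability.Probability" "Jordan_Normal_Form.Determinant"
begin

(* Coordinates are indexed by 0, ..., d - 1; points of R^d are extensional functions
   on {..<d}, so that Lebesgue measure on R^d is a finite product of copies of lborel. *)

definition weyl_chamber :: "nat \<Rightarrow> (nat \<Rightarrow> real) set" where
  "weyl_chamber d = {x \<in> {..<d} \<rightarrow>\<^sub>E UNIV. mono_on {..<d} x}"

abbreviation lebesgue_prod :: "nat \<Rightarrow> (nat \<Rightarrow> real) measure" where
  "lebesgue_prod d \<equiv> \<Pi>\<^sub>M j\<in>{..<d}. lborel"

definition walk ::
    "nat \<Rightarrow> (nat \<Rightarrow> nat \<Rightarrow> 'a \<Rightarrow> real) \<Rightarrow> (nat \<Rightarrow> real) \<Rightarrow> nat \<Rightarrow> 'a \<Rightarrow> nat \<Rightarrow> real" where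
  "walk d X x n \<omega> = (\<lambda>j\<in>{..<d}. x j + (\<Sum>i=1..n. X i j \<omega>))"

(* The infimum is taken in enat: it is \<infinity> if the walk never leaves the chamber. *)
definition exit_time ::
    "nat \<Rightarrow> (nat \<Rightarrow> nat \<Rightarrow> 'a \<Rightarrow> real) \<Rightarrow> (nat \<Rightarrow> real) \<Rightarrow> 'a \<Rightarrow> enat" where
  "exit_time d X x \<omega> = Inf {enat n |n. 1 \<le> n \<and> walk d X x n \<omega> \<notin> weyl_chamber d}"

definition q :: "int \<Rightarrow> real \<Rightarrow> real" where
  "q m u = (if 1 \<le> m \<and> 0 < u then u ^ nat (m - 1) / fact (nat (m - 1)) else 0)"

end

theory Submission
  imports Defs
begin

text \<open>
  Let \<open>D\<^sub>n(z)\<close> be the determinant of the matrix with entries \<open>q (n + i - j) (z j - x i)\<close>. By the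
  Markov property, the density of the walk that has stayed in the chamber satisfies a recursion in
  the number of steps: the density after \<open>n + 1\<close> steps at \<open>z\<close> is the integral, over the points
  \<open>y\<close> of the chamber, of the density after \<open>n\<close> steps at \<open>y\<close> times the density of a single jump from
  \<open>y\<close> to \<open>z\<close>. A jump has density \<open>\<Prod>\<^sub>j l j * exp (- l j * (z j - y j))\<close> on \<open>y \<le> z\<close>, so the exponential
  factors telescope and what remains is the purely analytic identity
  \<open>\<integral> D\<^sub>n(y) dy = D\<^sub>n\<^sub>+\<^sub>1(z)\<close>, the integral being over the \<open>y\<close> in the chamber with \<open>y \<le> z\<close>
  coordinatewise (\<open>qdet_recursion\<close>). The recursion starts at \<open>n = 1\<close>, where the matrix is lower
  triangular and its determinant is the indicator of \<open>x < z\<close>.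

  To prove the identity, integrate out the last coordinate first. Given \<open>y\<^sub>0, ..., y\<^sub>k\<^sub>-\<^sub>1\<close>, the
  coordinate \<open>y\<^sub>k\<close> ranges over \<open>[y\<^sub>k\<^sub>-\<^sub>1, z\<^sub>k]\<close> and occurs only in column \<open>k\<close>. Since \<open>q (m + 1)\<close> is an
  antiderivative of \<open>q m\<close>, that column becomes the column of \<open>D\<^sub>n\<^sub>+\<^sub>1(z)\<close> minus the column with entries
  \<open>q (n + 1 + i - k) (y\<^sub>k\<^sub>-\<^sub>1 - x i)\<close>, and the latter is column \<open>k - 1\<close> of the same matrix, so that it does
  not contribute to the determinant. Thus the columns are replaced one by one
  (\<open>mixdet_has_integral\<close>).

  The antiderivative rule fails for \<open>m = 0\<close>: the function \<open>q 0\<close> is zero, whereas \<open>q 1\<close> jumps at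
  the origin. This is harmless. Index \<open>0\<close> occurs in column \<open>k\<close> only in rows \<open>i < k\<close>. If \<open>y\<^sub>k\<^sub>-\<^sub>1\<close> exceeds
  \<open>x\<^sub>k\<^sub>-\<^sub>1\<close>, the jump is outside the range of integration in all these rows; and otherwise the matrix has
  a block of zeros so large that its determinant vanishes before and after the integration
  (\<open>det_zero_block\<close>).
\<close>

section \<open>The kernels\<close>

lemma q_nonpos [simp]: "u \<le> 0 \<Longrightarrow> q m u = 0"
  by (simp add: q_def)

lemma q_nonpos_index [simp]: "m \<le> 0 \<Longrightarrow> q m u = 0"
  by (simp add: q_def)

lemma q_Suc_pos: "0 < u \<Longrightarrow> q (int k + 1) u = u ^ k / fact k"
  by (simp add: q_def)

lemma q_measurable [measurable]: "q m \<in> borel_measurable borel"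
  unfolding q_def by measurable

text \<open>
  For \<open>m \<ge> 1\<close> this is the fundamental theorem of calculus on the part of the interval to the right of
  \<open>c\<close>. For \<open>m = 0\<close> the left-hand side is zero, and \<open>c < a\<close> makes the two values of the step function
  \<open>q 1\<close> equal.
\<close>
lemma q_has_integral:
  fixes a b c :: real
  assumes ab: "a \<le> b" and m: "m \<noteq> 0 \<or> c < a"
  shows "((\<lambda>t. q m (t - c)) has_integral q (m + 1) (b - c) - q (m + 1) (a - c)) {a..b}"
proof (cases "m \<le> 0")
  case True
  have "q (m + 1) (b - c) - q (m + 1) (a - c) = 0"
    using True m ab by (cases "m = 0") (auto simp: q_def)
  then show ?thesis
    using True by (simp add: has_integral_0)
next
  case False
  define k where "k = nat (m - 1)"
  have mk: "m = int k + 1" "m + 1 = int (Suc k) + 1"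
    using False by (auto simp: k_def)
  \<comment> \<open>the point of \<open>{a..b}\<close> nearest to \<open>c\<close>: the integrand vanishes before it and is a monomial after it\<close>
  define s where "s = max a (min b c)"
  have s: "a \<le> s" "s \<le> b" using ab by (auto simp: s_def)
  have low: "((\<lambda>t. q m (t - c)) has_integral 0) {a..s}"
    by (rule has_integral_spike_finite[where S="{a}" and f="\<lambda>t. 0"])
       (auto simp: s_def max_def min_def split: if_splits)
  have F: "q (m + 1) (t - c) = (if c < t then (t - c) ^ Suc k / fact (Suc k) else 0)" for t
    unfolding mk(2) by (simp add: q_Suc_pos del: power_Suc fact_Suc of_nat_Suc)
  have high: "((\<lambda>t. q m (t - c)) has_integral q (m + 1) (b - c) - q (m + 1) (s - c)) {s..b}"
  proof (cases "c < b")
    case True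
    then have cs: "c \<le> s" by (auto simp: s_def)
    have "((\<lambda>t. (t - c) ^ k / fact k) has_integral
        (b - c) ^ Suc k / fact (Suc k) - (s - c) ^ Suc k / fact (Suc k)) {s..b}"
    proof (rule fundamental_theorem_of_calculus[OF s(2)])
      fix t assume "t \<in> {s..b}"
      have "((\<lambda>t. (t - c) ^ Suc k / fact (Suc k)) has_field_derivative
        (real (Suc k) * (t - c) ^ k) / fact (Suc k)) (at t within {s..b})"
        by (rule derivative_eq_intros refl | simp)+
      moreover have "(real (Suc k) * (t - c) ^ k) / fact (Suc k) = (t - c) ^ k / fact k"
        by (simp add: fact_Suc divide_simps del: of_nat_Suc)
      ultimately show "((\<lambda>t. (t - c) ^ Suc k / fact (Suc k)) has_vector_derivative
        (t - c) ^ k / fact k) (at t within {s..b})"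
        by (simp add: has_real_derivative_iff_has_vector_derivative)
    qed
    moreover have "q (m + 1) (b - c) - q (m + 1) (s - c) =
        (b - c) ^ Suc k / fact (Suc k) - (s - c) ^ Suc k / fact (Suc k)"
      using True cs unfolding F by auto
    ultimately have I: "((\<lambda>t. (t - c) ^ k / fact k) has_integral
        q (m + 1) (b - c) - q (m + 1) (s - c)) {s..b}" by simp
    show ?thesis
      by (rule has_integral_spike_finite[OF _ _ I, where S="{s}"])
         (use cs in \<open>auto simp: mk(1) q_Suc_pos\<close>)
  next
    case False
    then have "s = b" using ab by (auto simp: s_def)
    then show ?thesis using has_integral_refl(2)[of "\<lambda>t. q m (t - c)" b] by simp
  qed
  have "q (m + 1) (s - c) = q (m + 1) (a - c)"
    by (cases "c \<le> a") (auto simp: s_def max_def min_def)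
  with has_integral_combine[OF s low high] show ?thesis
    by simp
qed

section \<open>Determinants as functions of their entries\<close>

text \<open>
  Rows \<open>k, ..., d - 1\<close> have zeros in columns \<open>0, ..., k\<close>. A permutation whose term in the Leibniz formula
  avoids this block maps \<open>d - k\<close> rows injectively to the \<open>d - k - 1\<close> columns after \<open>k\<close>, which is
  impossible.
\<close>
lemma det_zero_block:
  fixes f :: "nat \<Rightarrow> nat \<Rightarrow> 'a :: comm_ring_1"
  assumes k: "k < d" and zero: "\<And>i j. k \<le> i \<Longrightarrow> i < d \<Longrightarrow> j \<le> k \<Longrightarrow> f i j = 0"
  shows "Determinant.det (mat d d (\<lambda>(i, j). f i j)) = 0"
proof -
  have "(\<Prod>i = 0..<d. mat d d (\<lambda>(i, j). f i j) $$ (i, p i)) = 0" if p: "p permutes {0..<d}" for p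
  proof -
    have "\<exists>i. k \<le> i \<and> i < d \<and> p i \<le> k"
    proof (rule ccontr)
      assume contra: "\<not> ?thesis"
      have "p ` {k..<d} \<subseteq> {Suc k..<d}"
      proof safe
        fix i assume i: "i \<in> {k..<d}"
        then have "p i \<in> {0..<d}" using permutes_in_image[OF p] by auto
        with contra i show "p i \<in> {Suc k..<d}" by auto
      qed
      moreover have "inj_on p {k..<d}"
        using permutes_inj[OF p] by (auto intro: inj_on_subset)
      ultimately have "card {k..<d} \<le> card {Suc k..<d}"
        by (intro card_inj_on_le) auto
      with k show False by simp
    qed
    then obtain i where i: "k \<le> i" "i < d" "p i \<le> k" by blast
    then show ?thesis
      using zero[OF i] k by (intro prod_zero bexI[of _ i]) auto
  qed
  then show ?thesis
    by (simp add: Determinant.det_def)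
qed

text \<open>
  The cofactors of a column do not involve its entries. Hence one family of coefficients \<open>C\<close> serves
  all matrices that agree off column \<open>k\<close>; this is what lets an integral over that column be taken entry
  by entry.
\<close>
lemma det_column_expansion:
  fixes f :: "nat \<Rightarrow> nat \<Rightarrow> 'a :: comm_ring_1"
  assumes k: "k < d"
  obtains C where
    "\<And>g. (\<And>i j. i < d \<Longrightarrow> j < d \<Longrightarrow> j \<noteq> k \<Longrightarrow> g i j = f i j) \<Longrightarrow>
      Determinant.det (mat d d (\<lambda>(i, j). g i j)) = (\<Sum>i<d. g i k * C i)"
proof
  fix g assume g: "\<And>i j. i < d \<Longrightarrow> j < d \<Longrightarrow> j \<noteq> k \<Longrightarrow> g i j = f i j"
  let ?A = "mat d d (\<lambda>(i, j). g i j)" and ?B = "mat d d (\<lambda>(i, j). f i j)"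
  have "mat_delete ?A i k = mat_delete ?B i k" if "i < d" for i
    using that k by (intro eq_matI) (auto simp: mat_delete_def intro!: g)
  then show "Determinant.det ?A = (\<Sum>i<d. g i k * cofactor ?B i k)"
    using k by (subst laplace_expansion_column[of _ d k]) (auto simp: cofactor_def intro!: sum.cong)
qed

lemma det_borel_measurable:
  fixes f :: "'b \<Rightarrow> nat \<Rightarrow> nat \<Rightarrow> real"
  assumes "\<And>i j. i < d \<Longrightarrow> j < d \<Longrightarrow> (\<lambda>w. f w i j) \<in> borel_measurable N"
  shows "(\<lambda>w. Determinant.det (mat d d (\<lambda>(i, j). f w i j))) \<in> borel_measurable N"
proof -
  have "Determinant.det (mat d d (\<lambda>(i, j). f w i j)) =
      (\<Sum>p\<in>{p. p permutes {0..<d}}. signof p * (\<Prod>i\<in>{0..<d}. f w i (p i)))" for w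
    using permutes_in_image[where S = "{0..<d}"]
    by (subst Determinant.det_def'[of _ d]) (auto intro!: sum.cong prod.cong arg_cong2[where f = "(*)"])
  moreover have "(\<lambda>w. f w i (p i)) \<in> borel_measurable N"
    if "p permutes {0..<d}" "i \<in> {0..<d}" for p i
    using that permutes_in_image[OF that(1), of i] by (intro assms) auto
  ultimately show ?thesis
    by (auto intro!: borel_measurable_sum borel_measurable_times borel_measurable_prod)
qed

section \<open>Independent variables with densities\<close>

lemma product_sigma_finite_lborel: "product_sigma_finite (\<lambda>_. lborel :: real measure)"
  by (simp add: product_sigma_finite_def lborel.sigma_finite_measure_axioms)

text \<open>
  The joint law is the product of the marginal laws. Both it and the measure with the product density
  are determined by their values on boxes, where Tonelli's theorem factors the integral of the
  density.
\<close>
lemma (in prob_space) distributed_indep_vars_PiM: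
  fixes V :: "'i \<Rightarrow> 'a \<Rightarrow> real" and f :: "'i \<Rightarrow> real \<Rightarrow> ennreal"
  assumes I: "finite I" "I \<noteq> {}" and indep: "indep_vars (\<lambda>_. borel) V I"
    and dens: "\<And>j. j \<in> I \<Longrightarrow> distributed M lborel (V j) (f j)"
  shows "distributed M (\<Pi>\<^sub>M j\<in>I. lborel) (\<lambda>\<omega>. \<lambda>j\<in>I. V j \<omega>) (\<lambda>z. \<Prod>j\<in>I. f j (z j))"
proof -
  interpret L: product_sigma_finite "\<lambda>_::'i. lborel :: real measure"
    by (rule product_sigma_finite_lborel)
  have f [measurable]: "f j \<in> borel_measurable borel" if "j \<in> I" for j
    using distributed_borel_measurable[OF dens[OF that]] by simp
  have V [measurable]: "V j \<in> borel_measurable M" if "j \<in> I" for j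
    using distributed_measurable[OF dens[OF that]] by simp
  have prod_meas: "(\<lambda>z. \<Prod>j\<in>I. f j (z j)) \<in> borel_measurable (\<Pi>\<^sub>M j\<in>I. lborel)"
    by (intro borel_measurable_prod_ennreal) measurable
  have law: "distr M borel (V j) = density lborel (f j)" if "j \<in> I" for j
    using distributed_distr_eq_density[OF dens[OF that]] by (simp cong: distr_cong)
  define P where "P = (\<lambda>j. if j \<in> I then density lborel (f j) else lborel)"
  interpret P: product_sigma_finite P
  proof (unfold product_sigma_finite_def, rule allI)
    fix j
    show "sigma_finite_measure (P j)"
    proof (cases "j \<in> I")
      case True
      interpret D: prob_space "distr M borel (V j)" using True by (intro prob_space_distr) auto
      show ?thesis using D.sigma_finite_measure_axioms True by (simp add: P_def law)
    qed (simp add: P_def lborel.sigma_finite_measure_axioms)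
  qed
  have "distr M (\<Pi>\<^sub>M j\<in>I. lborel) (\<lambda>\<omega>. \<lambda>j\<in>I. V j \<omega>) = distr M (\<Pi>\<^sub>M j\<in>I. borel) (\<lambda>\<omega>. \<lambda>j\<in>I. V j \<omega>)"
    by (intro distr_cong sets_PiM_cong) auto
  also have "\<dots> = (\<Pi>\<^sub>M j\<in>I. distr M borel (V j))"
    using indep I by (subst (asm) indep_vars_iff_distr_eq_PiM') auto
  also have "\<dots> = (\<Pi>\<^sub>M j\<in>I. P j)"
    by (intro PiM_cong) (auto simp: law P_def)
  also have "\<dots> = density (\<Pi>\<^sub>M j\<in>I. lborel) (\<lambda>z. \<Prod>j\<in>I. f j (z j))"
  proof (rule P.PiM_eqI[symmetric, OF I(1)])
    show "sets (density (\<Pi>\<^sub>M j\<in>I. lborel) (\<lambda>z. \<Prod>j\<in>I. f j (z j))) = sets (\<Pi>\<^sub>M j\<in>I. P j)"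
      unfolding sets_density by (intro sets_PiM_cong) (auto simp: P_def)
    fix A assume "\<And>j. j \<in> I \<Longrightarrow> A j \<in> sets (P j)"
    then have A [measurable]: "A j \<in> sets borel" if "j \<in> I" for j
      using that by (auto simp: P_def split: if_splits)
    have box: "(\<Pi>\<^sub>E j\<in>I. A j) \<in> sets (\<Pi>\<^sub>M j\<in>I. lborel)"
      using I(1) by (intro sets_PiM_I_finite) auto
    have "emeasure (density (\<Pi>\<^sub>M j\<in>I. lborel) (\<lambda>z. \<Prod>j\<in>I. f j (z j))) (\<Pi>\<^sub>E j\<in>I. A j) =
        (\<integral>\<^sup>+z. (\<Prod>j\<in>I. f j (z j)) * indicator (\<Pi>\<^sub>E j\<in>I. A j) z \<partial>(\<Pi>\<^sub>M j\<in>I. lborel))"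
      by (intro emeasure_density prod_meas box)
    also have "\<dots> = (\<integral>\<^sup>+z. (\<Prod>j\<in>I. f j (z j) * indicator (A j) (z j)) \<partial>(\<Pi>\<^sub>M j\<in>I. lborel))"
    proof (rule nn_integral_cong)
      fix z :: "'i \<Rightarrow> real" assume "z \<in> space (\<Pi>\<^sub>M j\<in>I. lborel)"
      then have "z \<in> extensional I" by (simp add: space_PiM PiE_def)
      then have "indicator (\<Pi>\<^sub>E j\<in>I. A j) z = (\<Prod>j\<in>I. indicator (A j) (z j) :: ennreal)"
        using I(1) by (auto simp: indicator_def PiE_def prod_zero_iff Pi_iff intro!: prod_zero)
      then show "(\<Prod>j\<in>I. f j (z j)) * indicator (\<Pi>\<^sub>E j\<in>I. A j) z =
          (\<Prod>j\<in>I. f j (z j) * indicator (A j) (z j))"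
        by (simp add: prod.distrib)
    qed
    also have "\<dots> = (\<Prod>j\<in>I. \<integral>\<^sup>+t. f j t * indicator (A j) t \<partial>lborel)"
      using I(1) by (intro L.product_nn_integral_prod) auto
    also have "\<dots> = (\<Prod>j\<in>I. emeasure (P j) (A j))"
      by (intro prod.cong) (auto simp: P_def emeasure_density)
    finally show "emeasure (density (\<Pi>\<^sub>M j\<in>I. lborel) (\<lambda>z. \<Prod>j\<in>I. f j (z j))) (\<Pi>\<^sub>E j\<in>I. A j) =
        (\<Prod>j\<in>I. emeasure (P j) (A j))" .
  qed
  finally show ?thesis
    using prod_meas unfolding distributed_def by (auto intro!: measurable_restrict)
qed

text \<open>
  Conditioning on one of two independent variables: the other one is replaced by an independent
  copy.
\<close>
lemma (in prob_space) nn_integral_indep_var: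
  assumes indep: "indep_var S Y T Z" and h [measurable]: "case_prod h \<in> borel_measurable (S \<Otimes>\<^sub>M T)"
  shows "(\<integral>\<^sup>+\<omega>. h (Y \<omega>) (Z \<omega>) \<partial>M) = (\<integral>\<^sup>+\<omega>. (\<integral>\<^sup>+\<omega>'. h (Y \<omega>) (Z \<omega>') \<partial>M) \<partial>M)"
proof -
  have Y [measurable]: "Y \<in> measurable M S" and Z [measurable]: "Z \<in> measurable M T"
    and joint: "distr M S Y \<Otimes>\<^sub>M distr M T Z = distr M (S \<Otimes>\<^sub>M T) (\<lambda>\<omega>. (Y \<omega>, Z \<omega>))"
    using indep by (auto simp: indep_var_distribution_eq)
  interpret Z: prob_space "distr M T Z" by (rule prob_space_distr) fact
  have "(\<integral>\<^sup>+\<omega>. h (Y \<omega>) (Z \<omega>) \<partial>M) = (\<integral>\<^sup>+p. case_prod h p \<partial>distr M (S \<Otimes>\<^sub>M T) (\<lambda>\<omega>. (Y \<omega>, Z \<omega>)))"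
    by (subst nn_integral_distr) auto
  also have "\<dots> = (\<integral>\<^sup>+y. (\<integral>\<^sup>+z. h y z \<partial>distr M T Z) \<partial>distr M S Y)"
    unfolding joint[symmetric] by (subst Z.nn_integral_fst[symmetric]) auto
  also have "\<dots> = (\<integral>\<^sup>+\<omega>. (\<integral>\<^sup>+z. h (Y \<omega>) z \<partial>distr M T Z) \<partial>M)"
    by (subst nn_integral_distr) auto
  also have "\<dots> = (\<integral>\<^sup>+\<omega>. (\<integral>\<^sup>+\<omega>'. h (Y \<omega>) (Z \<omega>') \<partial>M) \<partial>M)"
  proof (rule nn_integral_cong)
    fix \<omega> assume "\<omega> \<in> space M"
    then have "Y \<omega> \<in> space S" by (rule measurable_space[OF Y])
    then have "h (Y \<omega>) \<in> borel_measurable T" by measurable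
    then show "(\<integral>\<^sup>+z. h (Y \<omega>) z \<partial>distr M T Z) = (\<integral>\<^sup>+\<omega>'. h (Y \<omega>) (Z \<omega>') \<partial>M)"
      by (subst nn_integral_distr) auto
  qed
  finally show ?thesis .
qed

lemma mono_on_measurable [measurable]:
  "Measurable.pred (\<Pi>\<^sub>M j\<in>{..<d}. borel) (\<lambda>y. mono_on {..<d} (y :: nat \<Rightarrow> real))"
  "Measurable.pred (lebesgue_prod d) (\<lambda>y. mono_on {..<d} y)"
proof -
  have "(\<lambda>y. mono_on {..<d} y) = (\<lambda>y. \<forall>i\<in>{..<d}. \<forall>j\<in>{..<d}. i \<le> j \<longrightarrow> y i \<le> (y j :: real))"
    by (auto simp: monotone_on_def fun_eq_iff)
  also have "Measurable.pred (\<Pi>\<^sub>M j\<in>{..<d}. borel) \<dots>"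
  proof (intro pred_intros_logic pred_intros_finite)
    fix i j assume "i \<in> {..<d}" "j \<in> {..<d}"
    then show "Measurable.pred (\<Pi>\<^sub>M j\<in>{..<d}. borel) (\<lambda>y. y i \<le> (y j :: real))"
      unfolding Measurable.pred_def by (intro borel_measurable_le measurable_component_singleton)
  qed auto
  finally show 1: "Measurable.pred (\<Pi>\<^sub>M j\<in>{..<d}. borel) (\<lambda>y. mono_on {..<d} (y :: nat \<Rightarrow> real))" .
  have "sets (\<Pi>\<^sub>M j\<in>{..<d}. borel :: real measure) = sets (lebesgue_prod d)"
    by (intro sets_PiM_cong) auto
  with 1 show "Measurable.pred (lebesgue_prod d) (\<lambda>y. mono_on {..<d} y)"
    by (simp cong: measurable_cong_sets)
qed

section \<open>The integral recursion for the determinants\<close>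

text \<open>
  The intermediate stages of the integration: coordinates \<open>j \<ge> k\<close> have been integrated out, which
  raises the index of \<open>q\<close> in column \<open>j\<close> by one and replaces the variable \<open>y j\<close> by the upper limit
  \<open>z j\<close>.
\<close>
definition mixdet ::
  "nat \<Rightarrow> nat \<Rightarrow> (nat \<Rightarrow> real) \<Rightarrow> nat \<Rightarrow> (nat \<Rightarrow> real) \<Rightarrow> (nat \<Rightarrow> real) \<Rightarrow> real" where
  "mixdet d n x k y z = Determinant.det (mat d d (\<lambda>(i, j).
     if j < k then q (int n + int i - int j) (y j - x i)
     else q (int (Suc n) + int i - int j) (z j - x i)))"

definition qdet :: "nat \<Rightarrow> nat \<Rightarrow> (nat \<Rightarrow> real) \<Rightarrow> (nat \<Rightarrow> real) \<Rightarrow> real" where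
  "qdet d n x z = Determinant.det (mat d d (\<lambda>(i, j). q (int n + int i - int j) (z j - x i)))"

lemma mixdet_0: "mixdet d n x 0 y z = qdet d (Suc n) x z"
  unfolding mixdet_def qdet_def by simp

lemma mixdet_full: "mixdet d n x d y z = qdet d n x y"
  unfolding mixdet_def qdet_def by (intro arg_cong[where f=Determinant.det] cong_mat) auto

text \<open>
  Integrating out coordinate \<open>k\<close> turns column \<open>k\<close> into its final form minus the preceding column. For
  \<open>k = 0\<close> there is no preceding column; with \<open>x 0\<close> as the lower limit the subtracted column is zero,
  because \<open>x 0\<close> is the smallest of the starting points.
\<close>
lemma mixdet_has_integral:
  assumes n: "1 \<le> n" and k: "k < d" and x: "mono_on {..<d} x" and y: "mono_on {..<k} y"
    and a: "a = (if k = 0 then x 0 else y (k - 1))" and az: "a \<le> z k"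
  shows "((\<lambda>t. mixdet d n x (Suc k) (y(k := t)) z) has_integral mixdet d n x k y z) {a..z k}"
proof -
  define f where "f = (\<lambda>i j. if j < k then q (int n + int i - int j) (y j - x i)
     else q (int (Suc n) + int i - int j) (z j - x i))"
  obtain C where C: "\<And>g. (\<And>i j. i < d \<Longrightarrow> j < d \<Longrightarrow> j \<noteq> k \<Longrightarrow> g i j = f i j) \<Longrightarrow>
      Determinant.det (mat d d (\<lambda>(i, j). g i j)) = (\<Sum>i<d. g i k * C i)"
    using det_column_expansion[OF k] by blast
  have 1: "mixdet d n x (Suc k) (y(k := t)) z =
      (\<Sum>i<d. q (int n + int i - int k) (t - x i) * C i)" for t
    unfolding mixdet_def by (subst C) (auto simp: f_def)
  have 2: "mixdet d n x k y z = (\<Sum>i<d. q (int n + int i - int k + 1) (z k - x i) * C i)"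
    unfolding mixdet_def by (subst C) (auto simp: f_def algebra_simps)
  show ?thesis
  proof (cases "k = 0 \<or> x (k - 1) < a")
    case True
    have "((\<lambda>t. \<Sum>i<d. q (int n + int i - int k) (t - x i) * C i) has_integral
       (\<Sum>i<d. (q (int n + int i - int k + 1) (z k - x i) - q (int n + int i - int k + 1) (a - x i)) * C i))
       {a..z k}"
      \<comment> \<open>\<open>q 0\<close> can occur only in rows above \<open>k\<close>, whose points \<open>x i\<close> lie to the left of \<open>a\<close>\<close>
    proof (intro has_integral_sum has_integral_mult_left q_has_integral az)
      fix i assume i: "i \<in> {..<d}"
      show "int n + int i - int k \<noteq> 0 \<or> x i < a"
      proof (rule ccontr)
        assume contra: "\<not> ?thesis"
        then have "i < k" using n by auto
        then have "x i \<le> x (k - 1)" using k by (intro mono_onD[OF x]) auto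
        with True contra \<open>i < k\<close> show False by auto
      qed
    qed auto
    moreover have "(\<Sum>i<d. q (int n + int i - int k + 1) (a - x i) * C i) = 0"
    proof (cases "k = 0")
      case True
      have "x 0 \<le> x i" if "i < d" for i
        using that k by (intro mono_onD[OF x]) auto
      with True a show ?thesis by (intro sum.neutral) auto
    next
      case False
      \<comment> \<open>the subtracted column replicates column \<open>k - 1\<close>\<close>
      define g where "g = (\<lambda>i j. if j = k then f i (k - 1) else f i j)"
      have "(\<Sum>i<d. q (int n + int i - int k + 1) (a - x i) * C i) = (\<Sum>i<d. g i k * C i)"
        using False a by (intro sum.cong) (auto simp: g_def f_def algebra_simps of_nat_diff)
      also have "\<dots> = Determinant.det (mat d d (\<lambda>(i, j). g i j))"
        by (subst C) (auto simp: g_def)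
      also have "\<dots> = 0"
        using False k
        by (intro Determinant.det_identical_columns[of _ d "k - 1" k]) (auto simp: g_def intro!: eq_vecI)
      finally show ?thesis .
    qed
    ultimately show ?thesis
      unfolding 1 2 by (simp add: left_diff_distrib sum_subtractf)
  next
    case False
    then have k0: "0 < k" and yx: "y (k - 1) \<le> x (k - 1)" using a by auto
    \<comment> \<open>rows from \<open>k - 1\<close> on vanish in all columns up to \<open>k - 1\<close>, whatever the other columns contain\<close>
    have yz: "y j - x i \<le> 0" if "k - 1 \<le> i" "i < d" "j \<le> k - 1" for i j
    proof -
      have "y j \<le> y (k - 1)" using that k0 by (intro mono_onD[OF y]) auto
      also note yx
      also have "x (k - 1) \<le> x i" using that k by (intro mono_onD[OF x]) auto
      finally show ?thesis by simp
    qed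
    have "mixdet d n x (Suc k) (y(k := t)) z = 0" for t
      unfolding mixdet_def using k k0 yz by (intro det_zero_block[of "k - 1"]) auto
    moreover have "mixdet d n x k y z = 0"
      unfolding mixdet_def using k k0 yz by (intro det_zero_block[of "k - 1"]) auto
    ultimately show ?thesis by simp
  qed
qed

text \<open>
  The range of the first \<open>k\<close> coordinates. The bound \<open>x 0 \<le> y j\<close> costs nothing, as for ordered \<open>y\<close> the determinant
  vanishes where it fails, and it gives coordinate \<open>0\<close> a lower limit of integration like the others.
\<close>
definition below :: "(nat \<Rightarrow> real) \<Rightarrow> (nat \<Rightarrow> real) \<Rightarrow> nat \<Rightarrow> (nat \<Rightarrow> real) set" where
  "below x z k = {y. mono_on {..<k} y \<and> (\<forall>j<k. x 0 \<le> y j \<and> y j \<le> z j)}"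

lemma below_Suc:
  "y(k := t) \<in> below x z (Suc k) \<longleftrightarrow>
     y \<in> below x z k \<and> t \<in> {(if k = 0 then x 0 else y (k - 1))..z k}" (is "?L \<longleftrightarrow> ?R")
proof
  assume ?L
  then have m: "mono_on {..<Suc k} (y(k := t))"
    and b: "\<And>j. j < Suc k \<Longrightarrow> x 0 \<le> (y(k := t)) j \<and> (y(k := t)) j \<le> z j"
    by (auto simp: below_def)
  have "mono_on {..<k} y"
  proof (rule mono_onI)
    fix i j assume ij: "i \<in> {..<k}" "j \<in> {..<k}" "i \<le> j"
    then show "y i \<le> y j" using mono_onD[OF m, of i j] by (auto split: if_splits)
  qed
  moreover have "x 0 \<le> y j \<and> y j \<le> z j" if "j < k" for j
    using b[of j] that by (auto split: if_splits)
  moreover have "y (k - 1) \<le> t" if "k \<noteq> 0"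
  proof -
    have "(y(k := t)) (k - 1) \<le> (y(k := t)) k" by (rule mono_onD[OF m]) auto
    with that show ?thesis by (auto split: if_splits)
  qed
  ultimately show ?R
    using b[of k] by (auto simp: below_def)
next
  assume R: ?R
  then have m: "mono_on {..<k} y" and b: "\<And>j. j < k \<Longrightarrow> x 0 \<le> y j \<and> y j \<le> z j"
    by (auto simp: below_def)
  have yt: "y j \<le> t" if "j < k" for j
  proof -
    have "y j \<le> y (k - 1)" using that by (intro mono_onD[OF m]) auto
    with R that show ?thesis by auto
  qed
  have "x 0 \<le> t" using R b[of "k - 1"] by (auto split: if_splits)
  moreover have "mono_on {..<Suc k} (y(k := t))"
  proof (rule mono_onI)
    fix i j assume "i \<in> {..<Suc k}" "j \<in> {..<Suc k}" "i \<le> j"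
    then show "(y(k := t)) i \<le> (y(k := t)) j"
      using yt[of i] mono_onD[OF m, of i j] by (cases "j = k"; cases "i = k") auto
  qed
  ultimately show ?L
    using R b by (auto simp: below_def less_Suc_eq)
qed

lemma below_lower_le:
  assumes y: "y \<in> below x z k" and k: "k < d" and z: "mono_on {..<d} z" and x0: "x 0 \<le> z 0"
  shows "(if k = 0 then x 0 else y (k - 1)) \<le> z k"
proof (cases "k = 0")
  case False
  then have "y (k - 1) \<le> z (k - 1)" using y by (auto simp: below_def)
  also have "\<dots> \<le> z k" using k by (intro mono_onD[OF z]) auto
  finally show ?thesis using False by simp
qed (use x0 in simp)

text \<open>
  Each mixed determinant is the integral of the next one, so nonnegativity passes from \<open>k = d\<close> down to
  \<open>k = 0\<close>. Knowing it, the iterated integral can be computed with nonnegative integrals, where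
  Tonelli's theorem has no integrability conditions.
\<close>
lemma mixdet_nonneg:
  assumes n: "1 \<le> n" and x: "mono_on {..<d} x" and z: "mono_on {..<d} z" and x0: "x 0 \<le> z 0"
    and nonneg: "\<And>y. mono_on {..<d} y \<Longrightarrow> 0 \<le> qdet d n x y"
    and "k \<le> d" and "y \<in> below x z k"
  shows "0 \<le> mixdet d n x k y z"
  using \<open>k \<le> d\<close> \<open>y \<in> below x z k\<close>
proof (induction k arbitrary: y rule: inc_induct)
  case base
  then show ?case using nonneg by (simp add: mixdet_full below_def)
next
  case (step k)
  define a where "a = (if k = 0 then x 0 else y (k - 1))"
  have m: "mono_on {..<k} y" using step.prems by (simp add: below_def)
  have az: "a \<le> z k"
    unfolding a_def using step by (intro below_lower_le[where k = k and z = z and y = y and x = x, OF _ _ z x0]) auto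
  show ?case
  proof (rule has_integral_nonneg[OF mixdet_has_integral[where k = k and z = z and x = x and y = y, OF n _ x m a_def az]])
    fix t assume "t \<in> {a..z k}"
    with step.prems have "y(k := t) \<in> below x z (Suc k)"
      unfolding below_Suc by (simp only: a_def simp_thms)
    then show "0 \<le> mixdet d n x (Suc k) (y(k := t)) z"
      by (rule step.IH)
  qed (use step in simp)
qed

lemma mixdet_measurable [measurable]:
  assumes "k \<le> d"
  shows "(\<lambda>y. mixdet d n x k y z) \<in> borel_measurable (\<Pi>\<^sub>M j\<in>{..<k}. lborel)"
  unfolding mixdet_def
proof (rule det_borel_measurable)
  fix i j assume "i < d" "j < d"
  show "(\<lambda>y. if j < k then q (int n + int i - int j) (y j - x i)
      else q (int (Suc n) + int i - int j) (z j - x i)) \<in> borel_measurable (\<Pi>\<^sub>M j\<in>{..<k}. lborel)"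
    by (cases "j < k") (simp_all, measurable)
qed

lemma below_measurable [measurable]:
  "Measurable.pred (\<Pi>\<^sub>M j\<in>{..<k}. lborel) (\<lambda>y. y \<in> below x z k)"
proof -
  have "Measurable.pred (\<Pi>\<^sub>M j\<in>{..<k}. lborel)
      (\<lambda>y. mono_on {..<k} y \<and> (\<forall>j\<in>{..<k}. x 0 \<le> y j \<and> y j \<le> z j))"
  proof (intro pred_intros_logic pred_intros_finite mono_on_measurable)
    fix j assume "j \<in> {..<k}"
    with measurable_component_singleton[of j "{..<k}" "\<lambda>_. lborel :: real measure"]
    have [measurable]: "(\<lambda>y. y j :: real) \<in> borel_measurable (\<Pi>\<^sub>M j\<in>{..<k}. lborel)"
      by simp
    show "Measurable.pred (\<Pi>\<^sub>M j\<in>{..<k}. lborel) (\<lambda>y. x 0 \<le> y j)"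
      "Measurable.pred (\<Pi>\<^sub>M j\<in>{..<k}. lborel) (\<lambda>y. y j \<le> z j)"
      by measurable
  qed simp
  then show ?thesis
    by (simp add: below_def Ball_def)
qed

lemma nn_integral_mixdet:
  assumes n: "1 \<le> n" and x: "mono_on {..<d} x" and z: "mono_on {..<d} z" and x0: "x 0 \<le> z 0"
    and nonneg: "\<And>y. mono_on {..<d} y \<Longrightarrow> 0 \<le> qdet d n x y"
    and "k \<le> d"
  shows "(\<integral>\<^sup>+y. indicator (below x z k) y * ennreal (mixdet d n x k y z) \<partial>(\<Pi>\<^sub>M j\<in>{..<k}. lborel))
     = ennreal (qdet d (Suc n) x z)"
  using \<open>k \<le> d\<close>
proof (induction k)
  case 0
  have "indicator (below x z 0) y = (1::ennreal)" for y
    by (simp add: below_def monotone_on_def)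
  then show ?case
    by (simp add: mixdet_0 PiM_empty nn_integral_count_space_finite)
next
  case (Suc k)
  interpret product_sigma_finite "\<lambda>_::nat. lborel :: real measure"
    by (rule product_sigma_finite_lborel)
  have [measurable]: "(\<lambda>y. indicator (below x z (Suc k)) y * ennreal (mixdet d n x (Suc k) y z))
      \<in> borel_measurable (\<Pi>\<^sub>M j\<in>insert k {..<k}. lborel)"
    using Suc.prems unfolding lessThan_Suc[symmetric] by measurable
  have "(\<integral>\<^sup>+y. indicator (below x z (Suc k)) y * ennreal (mixdet d n x (Suc k) y z)
        \<partial>(\<Pi>\<^sub>M j\<in>{..<Suc k}. lborel)) =
      (\<integral>\<^sup>+y. (\<integral>\<^sup>+t. indicator (below x z (Suc k)) (y(k := t)) *
          ennreal (mixdet d n x (Suc k) (y(k := t)) z) \<partial>lborel) \<partial>(\<Pi>\<^sub>M j\<in>{..<k}. lborel))"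
    unfolding lessThan_Suc by (rule product_nn_integral_insert) auto
  also have "\<dots> = (\<integral>\<^sup>+y. indicator (below x z k) y * ennreal (mixdet d n x k y z)
      \<partial>(\<Pi>\<^sub>M j\<in>{..<k}. lborel))"
  proof (rule nn_integral_cong)
    fix y
    show "(\<integral>\<^sup>+t. indicator (below x z (Suc k)) (y(k := t)) *
          ennreal (mixdet d n x (Suc k) (y(k := t)) z) \<partial>lborel) =
        indicator (below x z k) y * ennreal (mixdet d n x k y z)"
    proof (cases "y \<in> below x z k")
      case True
      define a where "a = (if k = 0 then x 0 else y (k - 1))"
      have m: "mono_on {..<k} y" using True by (simp add: below_def)
      have az: "a \<le> z k"
        unfolding a_def using Suc.prems by (intro below_lower_le[where k = k and z = z and x = x and y = y, OF True _ z x0]) auto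
      have "(\<integral>\<^sup>+t. indicator (below x z (Suc k)) (y(k := t)) *
          ennreal (mixdet d n x (Suc k) (y(k := t)) z) \<partial>lborel) =
        (\<integral>\<^sup>+t. ennreal (mixdet d n x (Suc k) (y(k := t)) z) * indicator {a..z k} t \<partial>lborel)"
        using True by (intro nn_integral_cong) (auto simp: below_Suc a_def indicator_def)
      also have "\<dots> = ennreal (mixdet d n x k y z)"
      proof (rule nn_integral_has_integral_lebesgue')
        show "((\<lambda>t. mixdet d n x (Suc k) (y(k := t)) z) has_integral mixdet d n x k y z) {a..z k}"
          using Suc.prems by (intro mixdet_has_integral[where k = k and z = z and x = x and y = y, OF n _ x m a_def az]) auto
        show "0 \<le> mixdet d n x (Suc k) (y(k := t)) z" if "t \<in> {a..z k}" for t
        proof -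
          have "y(k := t) \<in> below x z (Suc k)"
            using that True unfolding below_Suc by (simp only: a_def simp_thms)
          with Suc.prems show ?thesis
            by (intro mixdet_nonneg[OF n x z x0 nonneg])
        qed
      qed
      finally show ?thesis using True by simp
    next
      case False
      then show ?thesis by (simp add: below_Suc)
    qed
  qed
  also have "\<dots> = ennreal (qdet d (Suc n) x z)"
    using Suc by simp
  finally show ?case .
qed

lemma qdet_eq_0:
  assumes "0 < d" and x: "mono_on {..<d} x" and "z 0 \<le> x 0"
  shows "qdet d n x z = 0"
  unfolding qdet_def
proof (rule det_zero_block[of 0])
  fix i j :: nat assume ij: "0 \<le> i" "i < d" "j \<le> 0"
  have "x 0 \<le> x i" using ij assms(1) by (intro mono_onD[OF x]) auto
  with assms(3) ij show "q (int n + int i - int j) (z j - x i) = 0" by simp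
qed (use assms in simp)

text \<open>
  The matrix is lower triangular because \<open>q\<close> vanishes at indices \<open>m \<le> 0\<close>.
\<close>
lemma qdet_1:
  "qdet d 1 x z = (\<Prod>j<d. if x j < z j then 1 else 0)"
proof -
  let ?A = "mat d d (\<lambda>(i, j). q (int 1 + int i - int j) (z j - x i))"
  have "Determinant.det ?A = prod_list (diag_mat ?A)"
    by (rule det_lower_triangular[of d]) auto
  also have "\<dots> = (\<Prod>j<d. if x j < z j then 1 else 0)"
    unfolding diag_mat_def
    by (subst prod.distinct_set_conv_list[symmetric]) (auto simp: atLeast0LessThan q_def intro!: prod.cong)
  finally show ?thesis by (simp add: qdet_def)
qed

lemma qdet_nonneg:
  assumes "0 < d" and n: "1 \<le> n" and x: "mono_on {..<d} x" and z: "mono_on {..<d} z"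
  shows "0 \<le> qdet d n x z"
  using n z
proof (induction n arbitrary: z rule: dec_induct)
  case base
  then show ?case by (subst qdet_1) (auto intro!: prod_nonneg)
next
  case (step n)
  show ?case
  proof (cases "x 0 \<le> z 0")
    case True
    have "0 \<le> mixdet d n x 0 z z"
      using step by (intro mixdet_nonneg[OF _ x step.prems True]) (auto simp: below_def monotone_on_def)
    then show ?thesis by (simp add: mixdet_0)
  next
    case False
    then show ?thesis using qdet_eq_0[OF \<open>0 < d\<close> x, of z] by simp
  qed
qed

text \<open>
  The integrand vanishes unless \<open>x 0 \<le> y 0 \<le> z 0\<close>. Hence both sides are zero if \<open>z 0 < x 0\<close>, and
  otherwise integrating over one coordinate after the other applies.
\<close>
lemma qdet_recursion:
  assumes d: "0 < d" and n: "1 \<le> n" and x: "mono_on {..<d} x" and z: "mono_on {..<d} z"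
  shows "(\<integral>\<^sup>+y. indicator {y. mono_on {..<d} y \<and> (\<forall>j<d. y j \<le> z j)} y * ennreal (qdet d n x y)
      \<partial>lebesgue_prod d) = ennreal (qdet d (Suc n) x z)" (is "?I = _")
proof (cases "x 0 \<le> z 0")
  case True
  have "?I = (\<integral>\<^sup>+y. indicator (below x z d) y * ennreal (mixdet d n x d y z) \<partial>lebesgue_prod d)"
  proof (rule nn_integral_cong)
    fix y
    have "qdet d n x y = 0" if "mono_on {..<d} y" "j < d" "\<not> x 0 \<le> y j" for j
      using that mono_onD[OF that(1), of 0 j] by (intro qdet_eq_0[OF d x]) auto
    then show "indicator {y. mono_on {..<d} y \<and> (\<forall>j<d. y j \<le> z j)} y * ennreal (qdet d n x y) =
        indicator (below x z d) y * ennreal (mixdet d n x d y z)"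
      by (auto simp: mixdet_full below_def split: split_indicator)
  qed
  also have "\<dots> = ennreal (qdet d (Suc n) x z)"
    using qdet_nonneg[OF d n x] by (intro nn_integral_mixdet[OF n x z True]) auto
  finally show ?thesis .
next
  case False
  then have "ennreal (qdet d (Suc n) x z) = 0"
    using qdet_eq_0[OF d x, of z] by simp
  moreover have "?I = (\<integral>\<^sup>+y. 0 \<partial>lebesgue_prod d)"
  proof (rule nn_integral_cong)
    fix y
    have "qdet d n x y = 0" if "\<forall>j<d. y j \<le> z j"
      using that d False by (intro qdet_eq_0[OF d x]) force
    then show "indicator {y. mono_on {..<d} y \<and> (\<forall>j<d. y j \<le> z j)} y * ennreal (qdet d n x y) = 0"
      by (auto split: split_indicator)
  qed
  ultimately show ?thesis by simp
qed

lemma qdet_measurable [measurable]: "qdet d n x \<in> borel_measurable (lebesgue_prod d)"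
  unfolding qdet_def
proof (rule det_borel_measurable)
  fix i j assume "i < d" "j < d"
  with measurable_component_singleton[of j "{..<d}" "\<lambda>_. lborel :: real measure"]
  have [measurable]: "(\<lambda>z. z j :: real) \<in> borel_measurable (lebesgue_prod d)"
    by simp
  show "(\<lambda>z. q (int n + int i - int j) (z j - x i)) \<in> borel_measurable (lebesgue_prod d)"
    by measurable
qed

section \<open>The sub-densities and their recursion\<close>

definition subdensity_at ::
  "nat \<Rightarrow> (nat \<Rightarrow> real) \<Rightarrow> (nat \<Rightarrow> real) \<Rightarrow> nat \<Rightarrow> (nat \<Rightarrow> real) \<Rightarrow> real" where
  "subdensity_at d l x n z =
     (\<Prod>j<d. l j ^ n) * exp (- (\<Sum>j<d. l j * (z j - x j))) * qdet d n x z"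

lemma subdensity_at_measurable [measurable]:
  "subdensity_at d l x n \<in> borel_measurable (lebesgue_prod d)"
  unfolding subdensity_at_def by measurable

lemma subdensity_at_nonneg:
  assumes "1 \<le> d" "1 \<le> n" "\<And>j. j < d \<Longrightarrow> 0 < l j" "mono_on {..<d} x" "mono_on {..<d} z"
  shows "0 \<le> subdensity_at d l x n z"
  unfolding subdensity_at_def using assms
  by (intro mult_nonneg_nonneg qdet_nonneg prod_nonneg) (auto intro!: less_imp_le)

lemma prod_exponential_density:
  fixes d :: nat
  assumes "\<And>j. j < d \<Longrightarrow> 0 < l j"
  shows "(\<Prod>j<d. ennreal (exponential_density (l j) (z j - y j))) =
    (if \<forall>j<d. y j \<le> z j then ennreal ((\<Prod>j<d. l j) * exp (- (\<Sum>j<d. l j * (z j - y j)))) else 0)"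
proof (cases "\<forall>j<d. y j \<le> z j")
  case True
  have "(\<Prod>j<d. ennreal (exponential_density (l j) (z j - y j))) =
      (\<Prod>j<d. ennreal (l j * exp (- (l j * (z j - y j)))))"
    using True by (intro prod.cong) (auto simp: exponential_density_def algebra_simps)
  also have "\<dots> = ennreal (\<Prod>j<d. l j * exp (- (l j * (z j - y j))))"
    using assms by (intro prod_ennreal) (auto intro!: mult_nonneg_nonneg less_imp_le)
  also have "(\<Prod>j<d. l j * exp (- (l j * (z j - y j)))) =
      (\<Prod>j<d. l j) * exp (- (\<Sum>j<d. l j * (z j - y j)))"
    by (simp add: prod.distrib exp_sum flip: sum_negf)
  finally show ?thesis using True by simp
next
  case False
  then obtain j where "j < d" "z j < y j" by force
  then have "(\<Prod>j<d. ennreal (exponential_density (l j) (z j - y j))) = 0"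
    by (intro prod_zero bexI[of _ j]) (auto simp: exponential_density_def)
  with False show ?thesis by (simp only: if_False)
qed

text \<open>
  The jump density contributes \<open>exp (- l j * (z j - y j))\<close> to each coordinate, which combines with
  \<open>exp (- l j * (y j - x j))\<close> into a factor that is independent of \<open>y\<close>.
\<close>
lemma subdensity_recursion:
  assumes d: "1 \<le> d" and n: "1 \<le> n" and l: "\<And>j. j < d \<Longrightarrow> 0 < l j"
    and x: "mono_on {..<d} x" and z: "mono_on {..<d} z"
  shows "(\<integral>\<^sup>+y. indicator {y. mono_on {..<d} y} y * ennreal (subdensity_at d l x n y) *
      (\<Prod>j<d. ennreal (exponential_density (l j) (z j - y j))) \<partial>lebesgue_prod d) =
    ennreal (subdensity_at d l x (Suc n) z)"
proof -
  define w where "w = (\<Prod>j<d. l j ^ Suc n) * exp (- (\<Sum>j<d. l j * (z j - x j)))"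
  have w: "0 \<le> w"
    unfolding w_def using l
    by (intro mult_nonneg_nonneg prod_nonneg zero_le_power exp_ge_zero ballI less_imp_le) auto
  have "(\<integral>\<^sup>+y. indicator {y. mono_on {..<d} y} y * ennreal (subdensity_at d l x n y) *
      (\<Prod>j<d. ennreal (exponential_density (l j) (z j - y j))) \<partial>lebesgue_prod d) =
    (\<integral>\<^sup>+y. ennreal w * (indicator {y. mono_on {..<d} y \<and> (\<forall>j<d. y j \<le> z j)} y * ennreal (qdet d n x y))
      \<partial>lebesgue_prod d)"
  proof (rule nn_integral_cong)
    fix y
    show "indicator {y. mono_on {..<d} y} y * ennreal (subdensity_at d l x n y) *
        (\<Prod>j<d. ennreal (exponential_density (l j) (z j - y j))) =
      ennreal w * (indicator {y. mono_on {..<d} y \<and> (\<forall>j<d. y j \<le> z j)} y * ennreal (qdet d n x y))"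
    proof (cases "mono_on {..<d} y \<and> (\<forall>j<d. y j \<le> z j)")
      case True
      then have y: "mono_on {..<d} y" by simp
      have "(\<Sum>j<d. l j * (z j - x j)) = (\<Sum>j<d. l j * (y j - x j)) + (\<Sum>j<d. l j * (z j - y j))"
        by (simp add: sum.distrib[symmetric] algebra_simps)
      then have "subdensity_at d l x n y * ((\<Prod>j<d. l j) * exp (- (\<Sum>j<d. l j * (z j - y j)))) =
          w * qdet d n x y"
        by (simp add: subdensity_at_def w_def prod.distrib exp_add[symmetric] mult_ac)
      then have "ennreal (subdensity_at d l x n y) *
            ennreal ((\<Prod>j<d. l j) * exp (- (\<Sum>j<d. l j * (z j - y j)))) =
          ennreal w * ennreal (qdet d n x y)"
        using w subdensity_at_nonneg[OF d n l x y] qdet_nonneg[of d n x y] d n x y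
        by (simp add: ennreal_mult'[symmetric] ennreal_mult''[symmetric])
      with True show ?thesis
        by (simp add: prod_exponential_density[OF l])
    next
      case False
      then show ?thesis by (auto simp: prod_exponential_density[OF l] split: split_indicator)
    qed
  qed
  also have "\<dots> = ennreal w * ennreal (qdet d (Suc n) x z)"
    using d n x z
    by (subst nn_integral_cmult) (auto simp: qdet_recursion)
  also have "\<dots> = ennreal (subdensity_at d l x (Suc n) z)"
    using w by (simp add: subdensity_at_def w_def ennreal_mult'[symmetric])
  finally show ?thesis .
qed

text \<open>
  The determinant vanishes where some \<open>z j = x j\<close>, but the exponential density at \<open>0\<close> is positive.
  Equality at every point therefore requires the version of the jump density that is zero at the origin.
\<close>
lemma subdensity_1:
  fixes d :: nat
  assumes l: "\<And>j. j < d \<Longrightarrow> 0 < l j"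
  shows "ennreal (subdensity_at d l x 1 z) =
    (\<Prod>j<d. if z j = x j then 0 else ennreal (exponential_density (l j) (z j - x j)))"
proof (cases "\<forall>j<d. x j < z j")
  case True
  then have "(\<Prod>j<d. if z j = x j then 0 else ennreal (exponential_density (l j) (z j - x j))) =
     (\<Prod>j<d. ennreal (exponential_density (l j) (z j - x j)))"
    by (intro prod.cong) auto
  also have "\<dots> = ennreal ((\<Prod>j<d. l j) * exp (- (\<Sum>j<d. l j * (z j - x j))))"
    using True by (subst prod_exponential_density[OF l]) (auto intro: less_imp_le)
  also have "\<dots> = ennreal (subdensity_at d l x 1 z)"
    using True unfolding subdensity_at_def qdet_1 by simp
  finally show ?thesis ..
next
  case False
  then obtain j where j: "j < d" "z j \<le> x j" by force
  have "(\<Prod>j<d. if z j = x j then 0 else ennreal (exponential_density (l j) (z j - x j))) = 0"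
    using j by (intro prod_zero bexI[of _ j]) (auto simp: exponential_density_def)
  moreover have "qdet d 1 x z = 0"
    unfolding qdet_1 using j by (intro prod_zero bexI[of _ j]) auto
  ultimately show ?thesis by (simp add: subdensity_at_def)
qed

section \<open>The walk killed on leaving the chamber\<close>

lemma enat_less_exit_time_iff:
  "enat n < exit_time d X x \<omega> \<longleftrightarrow> (\<forall>k\<in>{1..n}. walk d X x k \<omega> \<in> weyl_chamber d)"
proof
  assume L: "enat n < exit_time d X x \<omega>"
  show "\<forall>k\<in>{1..n}. walk d X x k \<omega> \<in> weyl_chamber d"
  proof (rule ballI, rule ccontr)
    fix k assume "k \<in> {1..n}" "walk d X x k \<omega> \<notin> weyl_chamber d"
    then have "exit_time d X x \<omega> \<le> enat k"
      unfolding exit_time_def by (intro Inf_lower) auto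
    also have "\<dots> \<le> enat n" using \<open>k \<in> {1..n}\<close> by simp
    finally show False using L by simp
  qed
next
  assume R: "\<forall>k\<in>{1..n}. walk d X x k \<omega> \<in> weyl_chamber d"
  have "enat (Suc n) \<le> exit_time d X x \<omega>"
    unfolding exit_time_def
  proof (rule Inf_greatest, safe)
    fix k assume "1 \<le> k" "walk d X x k \<omega> \<notin> weyl_chamber d"
    with R have "\<not> k \<le> n" by auto
    then show "enat (Suc n) \<le> enat k" by simp
  qed
  then show "enat n < exit_time d X x \<omega>"
    by (metis enat_ord_simps(2) lessI less_le_trans)
qed

lemma walk_in_weyl_chamber_iff:
  "walk d X x n \<omega> \<in> weyl_chamber d \<longleftrightarrow> mono_on {..<d} (walk d X x n \<omega>)"
  by (auto simp: weyl_chamber_def walk_def)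

lemma walk_Suc:
  "walk d X x (Suc n) \<omega> = (\<lambda>j\<in>{..<d}. walk d X x n \<omega> j + X (Suc n) j \<omega>)"
  by (auto simp: walk_def)

locale exponential_walk = prob_space M for M :: "'a measure" +
  fixes X :: "nat \<Rightarrow> nat \<Rightarrow> 'a \<Rightarrow> real" and l x :: "nat \<Rightarrow> real" and d :: nat
  assumes d: "1 \<le> d"
    and rate: "\<And>j. j < d \<Longrightarrow> 0 < l j"
    and indep: "indep_vars (\<lambda>_. borel) (\<lambda>(i, j). X i j) ({1..} \<times> {..<d})"
    and step: "\<And>i j. 1 \<le> i \<Longrightarrow> j < d \<Longrightarrow> distributed M lborel (X i j) (exponential_density (l j))"
    and start: "mono_on {..<d} x"
begin

definition alive :: "nat \<Rightarrow> 'a set" where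
  "alive n = {\<omega>. \<forall>k\<in>{1..n}. mono_on {..<d} (walk d X x k \<omega>)}"

lemma step_measurable [measurable]:
  assumes "1 \<le> i" "j < d"
  shows "X i j \<in> borel_measurable M"
  using distributed_measurable[OF step[OF assms]] by simp

lemma walk_measurable [measurable]: "walk d X x n \<in> measurable M (lebesgue_prod d)"
  unfolding walk_def by (intro measurable_restrict) auto

lemma alive_measurable [measurable]: "Measurable.pred M (\<lambda>\<omega>. \<omega> \<in> alive n)"
  unfolding alive_def mem_Collect_eq by measurable

lemma indep_step:
  assumes "1 \<le> i"
  shows "indep_vars (\<lambda>_. borel) (X i) {..<d}"
proof -
  have "indep_vars (\<lambda>j. \<Pi>\<^sub>M p\<in>{(i, j)}. borel)
      (\<lambda>j \<omega>. \<lambda>p\<in>{(i, j)}. (case p of (i, j) \<Rightarrow> X i j) \<omega>) {..<d}"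
    using assms by (intro indep_vars_restrict[OF indep]) (auto simp: disjoint_family_on_def)
  then have "indep_vars (\<lambda>_. borel)
      (\<lambda>j \<omega>. (\<lambda>p\<in>{(i, j)}. (case p of (i, j) \<Rightarrow> X i j) \<omega>) (i, j)) {..<d}"
    by (rule indep_vars_compose2[where Y = "\<lambda>j f. f (i, j)"]) measurable
  then show ?thesis by simp
qed

lemma translated_step_distributed:
  assumes i: "1 \<le> i"
  shows "distributed M (lebesgue_prod d) (\<lambda>\<omega>. \<lambda>j\<in>{..<d}. y j + X i j \<omega>)
    (\<lambda>z. \<Prod>j<d. ennreal (exponential_density (l j) (z j - y j)))"
proof (rule distributed_indep_vars_PiM)
  show "indep_vars (\<lambda>_. borel) (\<lambda>j \<omega>. y j + X i j \<omega>) {..<d}"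
    using indep_vars_compose2[OF indep_step[OF i], of "\<lambda>j t. y j + t" "\<lambda>_. borel"] by simp
  show "distributed M lborel (\<lambda>\<omega>. y j + X i j \<omega>) (\<lambda>t. ennreal (exponential_density (l j) (t - y j)))"
    if "j \<in> {..<d}" for j
    using distributed_affine[OF step[OF i, of j], of 1 "y j"] that by (simp add: divide_ennreal_def)
qed (use d in \<open>auto simp: lessThan_empty_iff\<close>)

text \<open>
  A density may be changed on a null set; here it is set to zero on the hyperplanes \<open>z j = x j\<close>.
\<close>
lemma walk_1_distributed:
  "distributed M (lebesgue_prod d) (walk d X x 1)
    (\<lambda>z. \<Prod>j<d. if z j = x j then 0 else ennreal (exponential_density (l j) (z j - x j)))"
proof -
  have "distributed M (lebesgue_prod d) (\<lambda>\<omega>. \<lambda>j\<in>{..<d}. x j + X 1 j \<omega>)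
    (\<lambda>z. \<Prod>j<d. if z j = x j then 0 else ennreal (exponential_density (l j) (z j - x j)))"
  proof (rule distributed_indep_vars_PiM)
    show "indep_vars (\<lambda>_. borel) (\<lambda>j \<omega>. x j + X 1 j \<omega>) {..<d}"
      using indep_vars_compose2[OF indep_step[of 1], of "\<lambda>j t. x j + t" "\<lambda>_. borel"] by simp
    fix j assume j: "j \<in> {..<d}"
    have "distributed M lborel (\<lambda>\<omega>. x j + X 1 j \<omega>) (\<lambda>t. ennreal (exponential_density (l j) (t - x j)))"
      using distributed_affine[OF step[of 1 j], of 1 "x j"] j by (simp add: divide_ennreal_def)
    then show "distributed M lborel (\<lambda>\<omega>. x j + X 1 j \<omega>)
        (\<lambda>t. if t = x j then 0 else ennreal (exponential_density (l j) (t - x j)))"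
      by (subst distributed_cong_density[where g = "\<lambda>t. ennreal (exponential_density (l j) (t - x j))"])
         (use eventually_mono[OF AE_lborel_singleton[of "x j"]] in auto)
  qed (use d in \<open>auto simp: lessThan_empty_iff\<close>)
  moreover have "walk d X x 1 = (\<lambda>\<omega>. \<lambda>j\<in>{..<d}. x j + X 1 j \<omega>)"
    by (simp add: walk_def fun_eq_iff)
  ultimately show ?thesis by simp
qed

text \<open>
  The Markov property. Survival up to time \<open>n\<close> and the position at that time are functions of the
  variables with index at most \<open>n\<close>, which are independent of the next step.
\<close>
lemma nn_integral_markov:
  assumes g [measurable]: "g \<in> borel_measurable (lebesgue_prod d)"
  shows "(\<integral>\<^sup>+\<omega>. indicator (alive n) \<omega> * g (walk d X x (Suc n) \<omega>) \<partial>M) =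
    (\<integral>\<^sup>+\<omega>. indicator (alive n) \<omega> *
      (\<integral>\<^sup>+z. (\<Prod>j<d. ennreal (exponential_density (l j) (z j - walk d X x n \<omega> j))) * g z
        \<partial>lebesgue_prod d) \<partial>M)"
proof -
  let ?past = "{1..n} \<times> {..<d}" and ?next = "{Suc n} \<times> {..<d}"
  \<comment> \<open>the walk as a function of the family of its jumps, indexed by pairs (time, coordinate)\<close>
  define path where "path = (\<lambda>k (H :: nat \<times> nat \<Rightarrow> real). \<lambda>j\<in>{..<d}. x j + (\<Sum>i=1..k. H (i, j)))"
  define Y where "Y = (\<lambda>\<omega>. \<lambda>p\<in>?past. (case p of (i, j) \<Rightarrow> X i j) \<omega>)"
  define Z where "Z = (\<lambda>\<omega>. \<lambda>p\<in>?next. (case p of (i, j) \<Rightarrow> X i j) \<omega>)"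
  define h where "h = (\<lambda>H s. indicator {H. \<forall>k\<in>{1..n}. mono_on {..<d} (path k H)} H *
      g (\<lambda>j\<in>{..<d}. path n H j + s (Suc n, j)))"
  have YZ: "indep_var (\<Pi>\<^sub>M p\<in>?past. borel) Y (\<Pi>\<^sub>M p\<in>?next. borel) Z"
    unfolding Y_def Z_def by (rule indep_var_restrict[OF indep]) auto
  have path [measurable]: "path k \<in> measurable (\<Pi>\<^sub>M p\<in>?past. borel) (lebesgue_prod d)" if "k \<le> n" for k
    unfolding path_def using that by (intro measurable_restrict) auto
  have [measurable]: "(\<lambda>(H, s). \<lambda>j\<in>{..<d}. path n H j + s (Suc n, j))
      \<in> measurable ((\<Pi>\<^sub>M p\<in>?past. borel) \<Otimes>\<^sub>M (\<Pi>\<^sub>M p\<in>?next. borel)) (lebesgue_prod d)"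
    unfolding case_prod_beta path_def by (intro measurable_restrict) auto
  have h: "case_prod h \<in> borel_measurable ((\<Pi>\<^sub>M p\<in>?past. borel) \<Otimes>\<^sub>M (\<Pi>\<^sub>M p\<in>?next. borel))"
    unfolding h_def by measurable
  have path_Y: "path k (Y \<omega>) = walk d X x k \<omega>" if "k \<le> n" for k \<omega>
    using that by (auto simp: path_def walk_def Y_def fun_eq_iff intro!: sum.cong)
  have hYZ: "h (Y \<omega>) (Z \<omega>') = indicator (alive n) \<omega> * g (\<lambda>j\<in>{..<d}. walk d X x n \<omega> j + X (Suc n) j \<omega>')" for \<omega> \<omega>'
  proof -
    have "(\<lambda>j\<in>{..<d}. path n (Y \<omega>) j + Z \<omega>' (Suc n, j)) = (\<lambda>j\<in>{..<d}. walk d X x n \<omega> j + X (Suc n) j \<omega>')"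
      by (auto simp: path_Y Z_def)
    then show ?thesis
      by (auto simp: h_def alive_def path_Y indicator_def)
  qed
  have "(\<integral>\<^sup>+\<omega>. indicator (alive n) \<omega> * g (walk d X x (Suc n) \<omega>) \<partial>M) = (\<integral>\<^sup>+\<omega>. h (Y \<omega>) (Z \<omega>) \<partial>M)"
    by (simp add: hYZ walk_Suc)
  also have "\<dots> = (\<integral>\<^sup>+\<omega>. (\<integral>\<^sup>+\<omega>'. h (Y \<omega>) (Z \<omega>') \<partial>M) \<partial>M)"
    by (rule nn_integral_indep_var[OF YZ h])
  also have "\<dots> = (\<integral>\<^sup>+\<omega>. indicator (alive n) \<omega> *
      (\<integral>\<^sup>+z. (\<Prod>j<d. ennreal (exponential_density (l j) (z j - walk d X x n \<omega> j))) * g z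
        \<partial>lebesgue_prod d) \<partial>M)"
  proof (rule nn_integral_cong)
    fix \<omega>
    note D = translated_step_distributed[of "Suc n" "walk d X x n \<omega>"]
    have [measurable]: "(\<lambda>\<omega>'. \<lambda>j\<in>{..<d}. walk d X x n \<omega> j + X (Suc n) j \<omega>') \<in> measurable M (lebesgue_prod d)"
      by (rule distributed_measurable[OF D]) simp
    show "(\<integral>\<^sup>+\<omega>'. h (Y \<omega>) (Z \<omega>') \<partial>M) = indicator (alive n) \<omega> *
      (\<integral>\<^sup>+z. (\<Prod>j<d. ennreal (exponential_density (l j) (z j - walk d X x n \<omega> j))) * g z
        \<partial>lebesgue_prod d)"
      unfolding hYZ by (subst nn_integral_cmult) (auto simp: distributed_nn_integral[OF D g])
  qed
  finally show ?thesis .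
qed

text \<open>
  Stated for all test functions \<open>g\<close> and not only for indicators, since the induction applies the
  hypothesis to the expectation of a test function after one further jump.
\<close>
lemma nn_integral_alive:
  assumes "1 \<le> n" and "g \<in> borel_measurable (lebesgue_prod d)"
  shows "(\<integral>\<^sup>+\<omega>. indicator (alive n) \<omega> * g (walk d X x n \<omega>) \<partial>M) =
    (\<integral>\<^sup>+z. indicator {z. mono_on {..<d} z} z * ennreal (subdensity_at d l x n z) * g z \<partial>lebesgue_prod d)"
  using assms
proof (induction n arbitrary: g rule: dec_induct)
  case base
  note [measurable] = base
  have "(\<integral>\<^sup>+\<omega>. indicator (alive 1) \<omega> * g (walk d X x 1 \<omega>) \<partial>M) =
      (\<integral>\<^sup>+\<omega>. (\<lambda>z. indicator {z. mono_on {..<d} z} z * g z) (walk d X x 1 \<omega>) \<partial>M)"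
    by (intro nn_integral_cong) (auto simp: alive_def indicator_def)
  also have "\<dots> = (\<integral>\<^sup>+z. (\<Prod>j<d. if z j = x j then 0 else ennreal (exponential_density (l j) (z j - x j))) *
      (indicator {z. mono_on {..<d} z} z * g z) \<partial>lebesgue_prod d)"
    by (rule distributed_nn_integral[OF walk_1_distributed, symmetric]) measurable
  also have "\<dots> = (\<integral>\<^sup>+z. indicator {z. mono_on {..<d} z} z * ennreal (subdensity_at d l x 1 z) * g z \<partial>lebesgue_prod d)"
    using subdensity_1[OF rate] by (intro nn_integral_cong) (auto split: split_indicator)
  finally show ?case .
next
  case (step n)
  note [measurable] = step.prems
  interpret L: product_sigma_finite "\<lambda>_::nat. lborel :: real measure"
    by (rule product_sigma_finite_lborel)
  interpret N: finite_product_sigma_finite "\<lambda>_::nat. lborel :: real measure" "{..<d}"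
    by standard simp
  interpret NN: pair_sigma_finite "lebesgue_prod d" "lebesgue_prod d" ..
  let ?K = "\<lambda>y z. \<Prod>j<d. ennreal (exponential_density (l j) (z j - y j))"
  let ?W = "indicator {z. mono_on {..<d} z} :: (nat \<Rightarrow> real) \<Rightarrow> ennreal"
  let ?p = "\<lambda>n y. ennreal (subdensity_at d l x n y)"
  have [measurable]: "(\<lambda>(y, z). ?K y z) \<in> borel_measurable (lebesgue_prod d \<Otimes>\<^sub>M lebesgue_prod d)"
    unfolding case_prod_beta by (intro borel_measurable_prod_ennreal) auto
  have "(\<integral>\<^sup>+\<omega>. indicator (alive (Suc n)) \<omega> * g (walk d X x (Suc n) \<omega>) \<partial>M) =
      (\<integral>\<^sup>+\<omega>. indicator (alive n) \<omega> * (\<lambda>z. ?W z * g z) (walk d X x (Suc n) \<omega>) \<partial>M)"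
    by (intro nn_integral_cong) (auto simp: alive_def atLeastAtMostSuc_conv indicator_def)
  also have "\<dots> = (\<integral>\<^sup>+\<omega>. indicator (alive n) \<omega> *
      (\<integral>\<^sup>+z. ?K (walk d X x n \<omega>) z * (?W z * g z) \<partial>lebesgue_prod d) \<partial>M)"
    by (rule nn_integral_markov) measurable
  also have "\<dots> = (\<integral>\<^sup>+y. ?W y * ?p n y *
      (\<integral>\<^sup>+z. ?K y z * (?W z * g z) \<partial>lebesgue_prod d) \<partial>lebesgue_prod d)"
    by (rule step.IH) measurable
  also have "\<dots> = (\<integral>\<^sup>+y. (\<integral>\<^sup>+z. ?W z * g z * (?W y * ?p n y * ?K y z) \<partial>lebesgue_prod d) \<partial>lebesgue_prod d)"
    by (intro nn_integral_cong, subst nn_integral_cmult[symmetric]) (auto simp: mult_ac)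
  \<comment> \<open>exchanging the integrals makes the intermediate position the inner variable, as in the recursion\<close>
  also have "\<dots> = (\<integral>\<^sup>+z. (\<integral>\<^sup>+y. ?W z * g z * (?W y * ?p n y * ?K y z) \<partial>lebesgue_prod d) \<partial>lebesgue_prod d)"
    by (rule NN.Fubini'[symmetric]) measurable
  also have "\<dots> = (\<integral>\<^sup>+z. ?W z * g z * (\<integral>\<^sup>+y. ?W y * ?p n y * ?K y z \<partial>lebesgue_prod d) \<partial>lebesgue_prod d)"
    by (intro nn_integral_cong nn_integral_cmult) measurable
  also have "\<dots> = (\<integral>\<^sup>+z. ?W z * ?p (Suc n) z * g z \<partial>lebesgue_prod d)"
  proof (rule nn_integral_cong)
    fix z
    have "(\<integral>\<^sup>+y. ?W y * ?p n y * ?K y z \<partial>lebesgue_prod d) = ?p (Suc n) z" if "mono_on {..<d} z"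
      using d \<open>1 \<le> n\<close> rate start that by (rule subdensity_recursion)
    then show "?W z * g z * (\<integral>\<^sup>+y. ?W y * ?p n y * ?K y z \<partial>lebesgue_prod d) = ?W z * ?p (Suc n) z * g z"
      by (cases "mono_on {..<d} z") (simp_all add: mult_ac)
  qed
  finally show ?case .
qed

lemma has_bochner_integral_walk:
  assumes n: "1 \<le> n" and A [measurable]: "A \<in> sets (lebesgue_prod d)"
  shows "has_bochner_integral (lebesgue_prod d)
    (\<lambda>z. indicator (A \<inter> weyl_chamber d) z *\<^sub>R subdensity_at d l x n z)
    (measure M {\<omega> \<in> space M. walk d X x n \<omega> \<in> A \<and> enat n < exit_time d X x \<omega>})"
proof -
  let ?f = "\<lambda>z. indicator (A \<inter> {z. mono_on {..<d} z}) z *\<^sub>R subdensity_at d l x n z"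
  let ?E = "{\<omega> \<in> space M. walk d X x n \<omega> \<in> A \<and> enat n < exit_time d X x \<omega>}"
  have E: "?E = {\<omega> \<in> space M. walk d X x n \<omega> \<in> A \<and> \<omega> \<in> alive n}"
    by (auto simp: enat_less_exit_time_iff walk_in_weyl_chamber_iff alive_def)
  have [measurable]: "?E \<in> sets M"
    unfolding E by measurable
  have "has_bochner_integral (lebesgue_prod d) ?f (measure M ?E)"
  proof (rule has_bochner_integral_nn_integral)
    show "?f \<in> borel_measurable (lebesgue_prod d)"
      by measurable
    show "AE z in lebesgue_prod d. 0 \<le> ?f z"
      using subdensity_at_nonneg[OF d n rate start] by (auto simp: indicator_def)
    have "(\<integral>\<^sup>+z. ennreal (?f z) \<partial>lebesgue_prod d) =
        (\<integral>\<^sup>+z. indicator {z. mono_on {..<d} z} z * ennreal (subdensity_at d l x n z) * indicator A z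
          \<partial>lebesgue_prod d)"
      by (intro nn_integral_cong) (auto split: split_indicator)
    also have "\<dots> = (\<integral>\<^sup>+\<omega>. indicator (alive n) \<omega> * indicator A (walk d X x n \<omega>) \<partial>M)"
      by (intro nn_integral_alive[symmetric] n) measurable
    also have "\<dots> = (\<integral>\<^sup>+\<omega>. indicator ?E \<omega> \<partial>M)"
      by (intro nn_integral_cong) (auto simp: E indicator_def)
    also have "\<dots> = ennreal (measure M ?E)"
      by (simp add: emeasure_eq_measure)
    finally show "(\<integral>\<^sup>+z. ennreal (?f z) \<partial>lebesgue_prod d) = ennreal (measure M ?E)" .
  qed simp
  moreover have "indicator (A \<inter> weyl_chamber d) z = (indicator (A \<inter> {z. mono_on {..<d} z}) z :: real)" for z
    using sets.sets_into_space[OF A]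
    by (auto simp: indicator_def weyl_chamber_def space_PiM)
  ultimately show ?thesis
    by simp
qed

end

theorem proposition3:
  fixes M :: "'a measure"
    and X :: "nat \<Rightarrow> nat \<Rightarrow> 'a \<Rightarrow> real"
    and l :: "nat \<Rightarrow> real"
    and x :: "nat \<Rightarrow> real"
    and d n :: nat
    and A :: "(nat \<Rightarrow> real) set"
  assumes "prob_space M"
    and "1 \<le> d" and "1 \<le> n"
    and "\<And>j. j < d \<Longrightarrow> 0 < l j"
    and "prob_space.indep_vars M (\<lambda>_. borel) (\<lambda>(i, j). X i j) ({1..} \<times> {..<d})"
    and "\<And>i j. 1 \<le> i \<Longrightarrow> j < d \<Longrightarrow> distributed M lborel (X i j) (exponential_density (l j))"
    and "x \<in> weyl_chamber d"
    and "A \<in> sets (lebesgue_prod d)"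
  shows "has_bochner_integral (lebesgue_prod d)
    (\<lambda>z. indicator (A \<inter> weyl_chamber d) z *\<^sub>R
      ((\<Prod>j<d. l j ^ n) * exp (- (\<Sum>j<d. l j * (z j - x j))) *
        Determinant.det (mat d d (\<lambda>(i, j). q (int n + int i - int j) (z j - x i)))))
    (measure M {\<omega> \<in> space M. walk d X x n \<omega> \<in> A \<and> enat n < exit_time d X x \<omega>})"
proof -
  interpret prob_space M by fact
  interpret exponential_walk M X l x d
    by unfold_locales (use assms in \<open>auto simp: weyl_chamber_def\<close>)
  show ?thesis
    using has_bochner_integral_walk[OF assms(3,8)] by (simp only: subdensity_at_def qdet_def)
qed

end
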